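(* Let $0\le\alpha<\frac{\pi}{2}$, let $A\in\mathcal{S}_\alpha$ be an accretive $n\times n$ complex matrix, and let $t\in[0,1]$. Then $$\cos(t\alpha)\,\cos^{2t}\alpha\;w(A)^{-t}\le w(A^{-t}).$$
   Context: $\mathcal{M}_n$ is the algebra of complex $n\times n$ matrices. For $A\in\mathcal{M}_n$: $w(A)=\max\{|\langle Ax,x\rangle|:x\in\mathbb{C}^n,\|x\|=1\}$ is the numerical radius and $W(A)=\{\langle Ax,x\rangle:x\in\mathbb{C}^n,\|x\|=1\}$ is the numerical range. $A$ is accretive if $\Re A=\frac{A+A^*}{2}$ is positive definite. For $0\le\alpha<\pi/2$ let $S_\alpha=\{z\in\mathbb{C}:|\Im z|\le\tan\alpha\,\Re z\}$; we write $A\in\mathcal{S}_\alpha$ if $W(A)\subset S_\alpha$. Real powers of an accretive matrix (whose spectrum lies in the open right half plane) are principal powers, defined by the holomorphic functional calculus; $A^{-t}=(A^t)^{-1}$. *)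

theory Defs
  imports "HOL-Complex_Analysis.Complex_Analysis"
begin

definition cinner :: "complex ^ 'n \<Rightarrow> complex ^ 'n \<Rightarrow> complex" where
  "cinner x y = (\<Sum>i\<in>UNIV. x $ i * cnj (y $ i))"

definition ctranspose :: "complex ^ 'n ^ 'm \<Rightarrow> complex ^ 'm ^ 'n" where
  "ctranspose A = (\<chi> i j. cnj (A $ j $ i))"

definition mat_Re :: "complex ^ 'n ^ 'n \<Rightarrow> complex ^ 'n ^ 'n" where
  "mat_Re A = (1 / 2) *\<^sub>R (A + ctranspose A)"

definition pos_definite :: "complex ^ 'n ^ 'n \<Rightarrow> bool" where
  "pos_definite A \<longleftrightarrow> ctranspose A = A \<and> (\<forall>x. x \<noteq> 0 \<longrightarrow> 0 < Re (cinner (A *v x) x))"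

definition accretive :: "complex ^ 'n ^ 'n \<Rightarrow> bool" where
  "accretive A \<longleftrightarrow> pos_definite (mat_Re A)"

definition numerical_range :: "complex ^ 'n ^ 'n \<Rightarrow> complex set" where
  "numerical_range A = {cinner (A *v x) x |x. norm x = 1}"

text \<open>The supremum is attained, see \<open>numerical_radius_attained\<close> below.\<close>

definition numerical_radius :: "complex ^ 'n ^ 'n \<Rightarrow> real" where
  "numerical_radius A = (SUP x\<in>{x. norm x = 1}. cmod (cinner (A *v x) x))"

definition sector :: "real \<Rightarrow> complex set" where
  "sector \<alpha> = {z. \<bar>Im z\<bar> \<le> tan \<alpha> * Re z}"

definition sectorial :: "real \<Rightarrow> complex ^ 'n ^ 'n \<Rightarrow> bool" where
  "sectorial \<alpha> A \<longleftrightarrow> numerical_range A \<subseteq> sector \<alpha>"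

definition mat_spectrum :: "complex ^ 'n ^ 'n \<Rightarrow> complex set" where
  "mat_spectrum A = {z. \<not> invertible (mat z - A)}"

text \<open>Closed contours in \<open>U\<close> surrounding the spectrum of \<open>A\<close> once.\<close>

definition spectral_contour :: "complex set \<Rightarrow> complex ^ 'n ^ 'n \<Rightarrow> (real \<Rightarrow> complex) \<Rightarrow> bool" where
  "spectral_contour U A \<gamma> \<longleftrightarrow>
     valid_path \<gamma> \<and> pathfinish \<gamma> = pathstart \<gamma> \<and>
     path_image \<gamma> \<subseteq> U - mat_spectrum A \<and>
     (\<forall>z\<in>mat_spectrum A. winding_number \<gamma> z = 1) \<and>
     (\<forall>z. z \<notin> U \<longrightarrow> winding_number \<gamma> z = 0)"

text \<open>
  The Riesz--Dunford integral, entrywise, of a function holomorphic on an open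
  set \<open>U\<close> containing the spectrum; its value does not depend on the contour.
\<close>

definition hol_calculus ::
  "complex set \<Rightarrow> (complex \<Rightarrow> complex) \<Rightarrow> complex ^ 'n ^ 'n \<Rightarrow> complex ^ 'n ^ 'n" where
  "hol_calculus U f A =
     (let \<gamma> = (SOME \<gamma>. spectral_contour U A \<gamma>)
      in \<chi> i j. 1 / (2 * of_real pi * \<i>) *
           contour_integral \<gamma> (\<lambda>z. f z * matrix_inv (mat z - A) $ i $ j))"

text \<open>On complex numbers, \<open>powr\<close> is the principal power, holomorphic off the cut \<open>\<real>\<^sub>\<le>\<^sub>0\<close>.\<close>

definition mat_powr :: "complex ^ 'n ^ 'n \<Rightarrow> real \<Rightarrow> complex ^ 'n ^ 'n" where
  "mat_powr A t = hol_calculus (- \<real>\<^sub>\<le>\<^sub>0) (\<lambda>z. z powr of_real t) A"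

lemma continuous_on_cinner_mult [continuous_intros]:
  "continuous_on S (\<lambda>x. cinner (A *v x) x)"
  unfolding cinner_def matrix_vector_mult_def
  by (auto intro!: continuous_intros)

lemma compact_unit_sphere_vec: "compact {x :: complex ^ 'n. norm x = 1}"
  using compact_sphere[of "0 :: complex ^ 'n" 1] by (simp add: sphere_def dist_norm)

lemma unit_vec_exists: "\<exists>x :: complex ^ 'n. norm x = 1"
proof
  show "norm (axis undefined 1 :: complex ^ 'n) = 1" by (simp add: norm_axis_1)
qed

lemma numerical_radius_attained:
  fixes A :: "complex ^ 'n ^ 'n"
  shows "\<exists>x. norm x = 1 \<and> cmod (cinner (A *v x) x) = numerical_radius A"
    and "norm y = 1 \<Longrightarrow> cmod (cinner (A *v y) y) \<le> numerical_radius A"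
proof -
  let ?f = "\<lambda>x. cmod (cinner (A *v x) x)"
  obtain x where x: "norm x = 1" "\<And>y. norm y = 1 \<Longrightarrow> ?f y \<le> ?f x"
    using continuous_attains_sup[OF compact_unit_sphere_vec, of ?f] unit_vec_exists
    by (force intro: continuous_intros)
  have eq: "numerical_radius A = ?f x"
    unfolding numerical_radius_def by (rule cSup_eq_maximum) (use x in auto)
  show "\<exists>x. norm x = 1 \<and> ?f x = numerical_radius A" using x eq by auto
  show "?f y \<le> numerical_radius A" if "norm y = 1" using x that eq by auto
qed

lemma cinner_self: "cinner x x = of_real ((norm x)\<^sup>2)"
proof -
  have "(norm x)\<^sup>2 = (\<Sum>i\<in>UNIV. (cmod (x $ i))\<^sup>2)"
    by (simp add: norm_vec_def L2_set_def sum_nonneg)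
  thus ?thesis by (simp only: cinner_def of_real_sum complex_norm_square)
qed

lemma spectrum_subset_numerical_range: "mat_spectrum A \<subseteq> numerical_range A"
proof
  fix z assume "z \<in> mat_spectrum A"
  then obtain v where v: "(mat z - A) *v v = 0" "v \<noteq> 0"
    by (auto simp: mat_spectrum_def invertible_left_inverse matrix_left_invertible_ker)
  define x where "x = (1 / norm v) *\<^sub>R v"
  have mz: "mat z *v y = z *s y" for y :: "complex ^ 'n"
    by (simp add: vec_eq_iff matrix_vector_mult_def mat_def if_distrib[where f="\<lambda>a. a * _"]
        cong: if_cong)
  have "A *v v = z *s v" using v(1) by (simp add: matrix_vector_mult_diff_rdistrib mz)
  hence "A *v x = z *s x"
    by (simp add: x_def vec_eq_iff matrix_vector_mult_def scaleR_sum_right[symmetric])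
  moreover have nx: "norm x = 1" using v(2) by (simp add: x_def)
  moreover have "cinner (z *s x) x = z * cinner x x"
    by (simp add: cinner_def sum_distrib_left mult.assoc)
  ultimately show "z \<in> numerical_range A"
    unfolding numerical_range_def using cinner_self[of x] by force
qed

lemma Re_cinner_mat_Re: "Re (cinner (mat_Re A *v x) x) = Re (cinner (A *v x) x)"
proof -
  have 1: "cinner (ctranspose A *v x) x = cnj (cinner (A *v x) x)"
    unfolding cinner_def ctranspose_def matrix_vector_mult_def
    by (simp add: sum_distrib_right) (subst sum.swap, simp only: ac_simps)
  have "mat_Re A *v x = (1 / 2) *\<^sub>R (A *v x + ctranspose A *v x)"
    unfolding mat_Re_def
    by (simp add: vec_eq_iff matrix_vector_mult_def scaleR_sum_right sum.distrib[symmetric]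
        algebra_simps)
  hence "cinner (mat_Re A *v x) x = (1 / 2) *\<^sub>R (cinner (A *v x) x + cinner (ctranspose A *v x) x)"
    by (simp add: cinner_def scaleR_sum_right sum.distrib[symmetric] algebra_simps)
  thus ?thesis by (simp add: 1)
qed

text \<open>The contour in the definition of the principal power of an accretive matrix exists.\<close>

lemma accretive_spectral_contour_exists:
  assumes "accretive A"
  shows "\<exists>\<gamma>. spectral_contour (- \<real>\<^sub>\<le>\<^sub>0) A \<gamma>"
proof -
  let ?f = "\<lambda>x. cinner (A *v x) x"
  obtain m where m: "norm m = 1" "\<And>y. norm y = 1 \<Longrightarrow> Re (?f m) \<le> Re (?f y)"
    using continuous_attains_inf[OF compact_unit_sphere_vec, of "\<lambda>x. Re (?f x)"] unit_vec_exists
    by (force intro: continuous_intros)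
  define d where "d = Re (?f m)"
  define M where "M = numerical_radius A"
  have d0: "d > 0" using assms m(1) unfolding accretive_def pos_definite_def d_def
    by (metis Re_cinner_mat_Re norm_zero zero_neq_one)
  have sp: "Re z \<ge> d \<and> cmod z \<le> M" if "z \<in> mat_spectrum A" for z
    using that spectrum_subset_numerical_range[of A] m(2) numerical_radius_attained(2)[of _ A]
    unfolding numerical_range_def d_def M_def by blast
  define c where "c = M\<^sup>2 / d + d"
  define r where "r = c - d / 2"
  have cd: "c \<ge> d" "c * d > M\<^sup>2" using d0 by (auto simp: c_def field_simps)
  have r: "0 < r" "r < c" using cd d0 by (auto simp: r_def)
  have inb: "z \<in> ball (of_real c) r" if z: "z \<in> mat_spectrum A" for z
  proof -
    have "(cmod (z - of_real c))\<^sup>2 = (cmod z)\<^sup>2 - 2 * c * Re z + c\<^sup>2"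
      by (simp add: cmod_power2 power2_diff)
    also have "\<dots> \<le> M\<^sup>2 - 2 * c * d + c\<^sup>2"
      using sp[OF z] cd d0 by (intro add_mono diff_mono power_mono mult_left_mono) auto
    also have "\<dots> < r\<^sup>2"
      using cd(2) d0 by (simp add: r_def power2_diff) 
        (smt (verit) zero_less_power2 divide_pos_pos)
    finally have "cmod (z - of_real c) < r" using r(1) power2_less_imp_less by (meson less_imp_le)
    thus ?thesis by (simp add: dist_norm norm_minus_commute)
  qed
  have out: "z \<notin> cball (of_real c) r" if nz: "z \<in> \<real>\<^sub>\<le>\<^sub>0" for z :: complex
  proof -
    from nz obtain u where "z = of_real u" "u \<le> 0" by (auto simp: nonpos_Reals_def)
    hence "dist (of_real c) z = \<bar>c - u\<bar>"
      by (simp add: dist_norm flip: of_real_diff)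
    thus ?thesis using r \<open>u \<le> 0\<close> by auto
  qed
  let ?g = "circlepath (of_real c) r"
  have im: "path_image ?g = sphere (of_real c) r" using r by simp
  have "spectral_contour (- \<real>\<^sub>\<le>\<^sub>0) A ?g"
    unfolding spectral_contour_def
  proof (intro conjI ballI allI impI)
    show "path_image ?g \<subseteq> - \<real>\<^sub>\<le>\<^sub>0 - mat_spectrum A" 
      unfolding im using inb out by (force simp: dist_norm)
    fix z assume "z \<in> mat_spectrum A"
    thus "winding_number ?g z = 1"
      using inb[of z] by (intro winding_number_circlepath) (auto simp: dist_norm norm_minus_commute)
  next
    fix z :: complex assume "z \<notin> - \<real>\<^sub>\<le>\<^sub>0"
    hence "z \<notin> cball (of_real c) r" using out by auto
    thus "winding_number ?g z = 0"
      by (intro winding_number_zero_outside[of _ "cball (of_real c) r"])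
         (use r in \<open>auto simp: im\<close>)
  qed auto
  thus ?thesis by blast
qed

end

theory Submission
  imports Defs "HOL-Computational_Algebra.Fundamental_Theorem_Algebra"
begin

text \<open>
  If \<open>A v = \<lambda> v\<close> with \<open>v \<noteq> 0\<close>, then the resolvent acts on \<open>v\<close> as \<open>1 / (z - \<lambda>)\<close>, so Cauchy's formula
  gives \<open>A\<^sup>t v = \<lambda>\<^sup>t v\<close>. Hence \<open>\<lambda>\<^sup>-\<^sup>t\<close> is an eigenvalue of \<open>A\<^sup>-\<^sup>t\<close>, and
  \<open>w(A\<^sup>-\<^sup>t) \<ge> \<bar>\<lambda>\<bar>\<^sup>-\<^sup>t \<ge> w(A)\<^sup>-\<^sup>t\<close> because \<open>\<bar>\<lambda>\<bar> \<le> w(A)\<close>; the cosine factors are at most 1.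
  That \<open>A\<^sup>t\<close> is invertible follows the same way: its kernel is \<open>A\<close>-invariant, so if it were
  nonzero it would contain an eigenvector of \<open>A\<close>, on which \<open>A\<^sup>t\<close> acts as \<open>\<lambda>\<^sup>t \<noteq> 0\<close>.
\<close>

section \<open>Scalar matrices and inverses acting on vectors\<close>

lemma mat_vector_mult: "mat z *v (x :: 'a::comm_semiring_1 ^ 'n) = z *s x"
  by (simp add: vec_eq_iff matrix_vector_mult_def mat_def if_distrib[where f="\<lambda>a. a * _"] cong: if_cong)

lemma matrix_inv_vector_mult:
  assumes "invertible (M :: 'a::field ^ 'n ^ 'n)"
  shows "M *v (matrix_inv M *v x) = x" and "matrix_inv M *v (M *v x) = x"
proof -
  have "M ** matrix_inv M = mat 1 \<and> matrix_inv M ** M = mat 1"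
    using assms unfolding invertible_def matrix_inv_def by (rule someI_ex)
  thus "M *v (matrix_inv M *v x) = x" "matrix_inv M *v (M *v x) = x"
    by (simp_all add: matrix_vector_mul_assoc)
qed

subsection \<open>Eigenvectors in invariant subspaces\<close>

text \<open>This is the vector p(A)u. It iterates the action of \<open>A\<close> on \<open>u\<close>
  because the multiplication of this matrix type is entrywise.\<close>

definition poly_vec :: "'a::field ^ 'n ^ 'n \<Rightarrow> 'a poly \<Rightarrow> 'a ^ 'n \<Rightarrow> 'a ^ 'n" where
  "poly_vec A p u = (\<Sum>i\<le>degree p. coeff p i *s (((*v) A ^^ i) u))"

lemma poly_vec_altdef:
  assumes "degree p < n"
  shows "poly_vec A p u = (\<Sum>i<n. coeff p i *s (((*v) A ^^ i) u))"
  unfolding poly_vec_def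
  by (rule sum.mono_neutral_left) (use assms in \<open>auto simp: coeff_eq_0\<close>)

text \<open>A - l commutes with every power of A, so a linear factor of the polynomial can be moved
  onto the vector. This lowers the degree in the search for an eigenvector.\<close>

lemma poly_vec_linear_factor:
  "poly_vec A ([:- l, 1:] * q) u = poly_vec A q (A *v u - l *s u)"
proof -
  have comm: "((*v) A ^^ i) (A *v u) = A *v ((*v) A ^^ i) u" for i u
    by (induction i) auto
  have pow_diff: "((*v) A ^^ i) (A *v u - l *s u)
      = ((*v) A ^^ Suc i) u - l *s ((*v) A ^^ i) u" for i
    by (induction i) (auto simp: matrix_vector_mult_diff_distrib vector_scalar_commute)
  \<comment> \<open>With this choice \<open>n\<close> exceeds the degree of \<open>q\<close> and
    \<open>Suc n\<close> exceeds that of the product, as \<open>poly_vec_altdef\<close>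
    requires.\<close>
  define n where "n = Suc (degree q)"
  have "degree ([:- l, 1:] * q) \<le> degree [:- l, 1:] + degree q" by (rule degree_mult_le)
  \<comment> \<open>The product has the coefficients of Xq minus l times those of q. The first sum
    is then reindexed; the second loses its last term, which is zero.\<close>
  hence "poly_vec A ([:- l, 1:] * q) u
      = (\<Sum>i<Suc n. coeff (pCons 0 q) i *s ((*v) A ^^ i) u)
        - (\<Sum>i<Suc n. (l * coeff q i) *s ((*v) A ^^ i) u)"
    by (subst poly_vec_altdef[of _ "Suc n"])
       (auto simp: n_def sum_subtractf[symmetric] vec.scale_left_diff_distrib intro!: sum.cong)
  also have "(\<Sum>i<Suc n. coeff (pCons 0 q) i *s ((*v) A ^^ i) u)
      = (\<Sum>i<n. coeff q i *s ((*v) A ^^ Suc i) u)"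
    by (subst sum.lessThan_Suc_shift) simp
  also have "(\<Sum>i<Suc n. (l * coeff q i) *s ((*v) A ^^ i) u)
      = (\<Sum>i<n. (l * coeff q i) *s ((*v) A ^^ i) u)"
    by (simp add: n_def coeff_eq_0)
  also have "(\<Sum>i<n. coeff q i *s ((*v) A ^^ Suc i) u) - \<dots> = poly_vec A q (A *v u - l *s u)"
    by (subst poly_vec_altdef[of _ n])
       (auto simp: n_def pow_diff sum_subtractf[symmetric] vec.scale_right_diff_distrib mult.commute
          simp del: funpow.simps intro!: sum.cong)
  finally show ?thesis .
qed

text \<open>The n + 1 vectors u, Au, ..., A^n u lie in a space of dimension n; the coefficients of a
  linear relation among them form the polynomial.\<close>

lemma ex_annihilating_poly:
  fixes u :: "'a::field ^ 'n"
  shows "\<exists>p. p \<noteq> 0 \<and> poly_vec A p u = 0"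
proof -
  define f where "f i = ((*v) A ^^ i) u" for i
  define n where "n = CARD('n)"
  show ?thesis
  \<comment> \<open>Linear dependence is a property of sets and does not see repetitions, so
    repeated iterates are treated apart.\<close>
  proof (cases "inj_on f {..n}")
    case True
    have "vec.dependent (f ` {..n})"
    proof (rule ccontr)
      assume "\<not> vec.dependent (f ` {..n})"
      hence "card (f ` {..n}) \<le> card (cart_basis :: ('a ^ 'n) set)"
        using vec.independent_span_bound[of cart_basis "f ` {..n}"]
        by (simp add: finite_cart_basis)
      thus False using True by (simp add: card_image card_cart_basis n_def)
    qed
    then obtain S c v where S: "finite S" "S \<subseteq> f ` {..n}" "(\<Sum>v\<in>S. c v *s v) = 0" "v \<in> S" "c v \<noteq> 0"
      unfolding vec.dependent_explicit by blast
    define I where "I = {i \<in> {..n}. f i \<in> S}"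
    have SI: "S = f ` I" using S(2) by (auto simp: I_def)
    have fin: "finite I" and inj: "inj_on f I"
      using True by (auto simp: I_def intro: inj_on_subset)
    \<comment> \<open>Injectivity on \<open>I\<close> turns the coefficients indexed by vectors into
      coefficients indexed by exponents.\<close>
    define p where "p = (\<Sum>i\<in>I. monom (c (f i)) i)"
    have co: "coeff p i = (if i \<in> I then c (f i) else 0)" for i
      using fin by (simp add: p_def coeff_sum)
    obtain i where "i \<in> I" "c (f i) \<noteq> 0" using S(4,5) SI by auto
    hence "p \<noteq> 0" using co[of i] by auto
    have "degree p < Suc n"
      by (intro le_imp_less_Suc degree_le) (auto simp: co I_def)
    hence "poly_vec A p u = (\<Sum>i<Suc n. if i \<in> I then c (f i) *s f i else 0)"
      by (subst poly_vec_altdef[of _ "Suc n"]) (auto simp: co f_def intro!: sum.cong)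
    also have "\<dots> = (\<Sum>i\<in>I. c (f i) *s f i)"
      using fin by (intro sum.mono_neutral_cong_right) (auto simp: I_def)
    also have "\<dots> = 0" using S(3) SI inj by (simp add: sum.reindex)
    finally show ?thesis using \<open>p \<noteq> 0\<close> by blast
  next
    case False
    then obtain i j where ij: "i < j" "f i = f j"
      unfolding inj_on_def by (metis linorder_neqE_nat)
    \<comment> \<open>A repetition A^i u = A^j u is itself a relation, given by X^j - X^i.\<close>
    define p where "p = monom 1 j - (monom 1 i :: 'a poly)"
    have "coeff p j = 1" using ij by (simp add: p_def)
    hence "p \<noteq> 0" by auto
    have "degree p < Suc j"
      using ij by (intro le_imp_less_Suc degree_le) (auto simp: p_def)
    hence "poly_vec A p u = (\<Sum>k<Suc j. (if k = j then f k else 0) - (if k = i then f k else 0))"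
      using ij by (subst poly_vec_altdef[of _ "Suc j"]) (auto simp: p_def f_def intro!: sum.cong)
    also have "\<dots> = 0"
      using ij by (simp only: sum_subtractf) (simp add: sum.delta)
    finally show ?thesis using \<open>p \<noteq> 0\<close> by blast
  qed
qed

text \<open>Induction on the degree of a polynomial annihilating u: for a root l, either (A - l)u =
  0 and u is an eigenvector, or (A - l)u is a nonzero vector of K annihilated by the cofactor of
  smaller degree.\<close>

lemma invariant_subspace_eigenvector:
  fixes A :: "'a::alg_closed_field ^ 'n ^ 'n"
  assumes K: "vec.subspace K" and inv: "\<And>x. x \<in> K \<Longrightarrow> A *v x \<in> K"
    and u: "u \<in> K" "u \<noteq> 0"
  shows "\<exists>l v. v \<in> K \<and> v \<noteq> 0 \<and> A *v v = l *s v"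
proof -
  obtain p where "p \<noteq> 0" "poly_vec A p u = 0" using ex_annihilating_poly by blast
  thus ?thesis using u
  proof (induction "degree p" arbitrary: p u)
    case 0
    \<comment> \<open>A nonzero constant cannot annihilate the nonzero \<open>u\<close>, so this
      case is contradictory.\<close>
    then obtain c where "p = [:c:]" "c \<noteq> 0" by (metis degree_eq_zeroE pCons_0_0)
    with 0 show ?case by (simp add: poly_vec_def)
  next
    case (Suc d)
    then obtain l where "poly p l = 0" using alg_closed_imp_poly_has_root[of p] by auto
    then obtain q where q: "p = [:- l, 1:] * q" by (auto simp: poly_eq_0_iff_dvd elim: dvdE)
    with Suc.prems have q0: "q \<noteq> 0" by auto
    have "degree p = Suc (degree q)" using q0 unfolding q by (subst degree_mult_eq) auto
    hence d: "d = degree q" using Suc.hyps by simp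
    define v where "v = A *v u - l *s u"
    have "v \<in> K" unfolding v_def
      using Suc.prems K inv by (intro vec.subspace_diff vec.subspace_scale) auto
    moreover have "poly_vec A q v = 0" 
      using Suc.prems(2) unfolding q poly_vec_linear_factor v_def .
    ultimately show ?case
      using Suc.hyps(1)[OF d q0] Suc.prems by (cases "v = 0") (auto simp: v_def)
  qed
qed

subsection \<open>The functional calculus on vectors\<close>

lemma mem_mat_spectrum_iff: "z \<in> mat_spectrum A \<longleftrightarrow> det (mat z - A) = 0"
  by (simp add: mat_spectrum_def invertible_det_nz)

lemma eigenvalue_in_mat_spectrum:
  assumes "A *v v = l *s v" "v \<noteq> 0"
  shows "l \<in> mat_spectrum A"
proof -
  have "(mat l - A) *v v = 0"
    by (simp add: matrix_vector_mult_diff_rdistrib mat_vector_mult assms)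
  thus ?thesis
    using assms(2) by (auto simp: mat_spectrum_def invertible_left_inverse matrix_left_invertible_ker)
qed

lemma holomorphic_on_det:
  fixes F :: "complex \<Rightarrow> complex ^ 'n ^ 'n"
  assumes "\<And>i j. (\<lambda>z. F z $ i $ j) holomorphic_on S"
  shows "(\<lambda>z. det (F z)) holomorphic_on S"
  unfolding det_def by (intro holomorphic_intros assms)

lemma holomorphic_on_mat_minus:
  "(\<lambda>z. (mat z - A) $ i $ j) holomorphic_on S"
  by (cases "i = j") (auto simp: mat_def intro!: holomorphic_intros)

lemma open_resolvent_set: "open (- mat_spectrum A)"
proof -
  have "continuous_on UNIV (\<lambda>z. det (mat z - A))"
    by (intro holomorphic_on_imp_continuous_on holomorphic_on_det holomorphic_on_mat_minus)
  hence "open {z. det (mat z - A) \<noteq> 0}"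
    by (intro open_Collect_neq) auto
  moreover have "- mat_spectrum A = {z. det (mat z - A) \<noteq> 0}"
    by (auto simp: mem_mat_spectrum_iff)
  ultimately show ?thesis by simp
qed

text \<open>By Cramer's rule each entry is a quotient of determinants that are polynomial in z, and
  the denominator vanishes only on the spectrum.\<close>

lemma holomorphic_on_resolvent:
  fixes A :: "complex ^ 'n ^ 'n"
  shows "(\<lambda>z. matrix_inv (mat z - A) $ i $ j) holomorphic_on (- mat_spectrum A)"
proof -
  define b :: "complex ^ 'n" where "b = axis j 1"
  \<comment> \<open>Column \<open>i\<close> is replaced by the \<open>j\<close>-th unit vector, so
    Cramer's rule yields entry (i, j) of the inverse.\<close>
  let ?M = "\<lambda>z. \<chi> k l. if l = i then b $ k else (mat z - A) $ k $ l"
  have eq: "matrix_inv (mat z - A) $ i $ j = det (?M z) / det (mat z - A)"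
    if "z \<in> - mat_spectrum A" for z
  proof -
    have "(mat z - A) *v (matrix_inv (mat z - A) *v b) = b"
      using that by (intro matrix_inv_vector_mult) (auto simp: mat_spectrum_def)
    moreover have "det (mat z - A) \<noteq> 0" using that by (simp add: mem_mat_spectrum_iff)
    ultimately have "(matrix_inv (mat z - A) *v b) $ i = det (?M z) / det (mat z - A)"
      by (simp add: cramer)
    moreover have "(matrix_inv (mat z - A) *v b) $ i = matrix_inv (mat z - A) $ i $ j"
      by (simp add: b_def matrix_vector_mult_def axis_def if_distrib[where f="\<lambda>a. _ * a"] cong: if_cong)
    ultimately show ?thesis by simp
  qed
  have "(\<lambda>z. (?M z) $ k $ l) holomorphic_on S" for k l S
    using holomorphic_on_mat_minus[of A k l S] by (cases "l = i") auto
  hence "(\<lambda>z. det (?M z) / det (mat z - A)) holomorphic_on (- mat_spectrum A)"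
    by (intro holomorphic_on_divide holomorphic_on_det holomorphic_on_mat_minus)
       (auto simp: mem_mat_spectrum_iff)
  thus ?thesis by (rule holomorphic_transform) (simp add: eq)
qed

text \<open>Write v = (z - A)y. Applying A gives Av = (z - A)Ay, and the resolvent sends this to
  Ay.\<close>

lemma resolvent_commute:
  assumes "z \<notin> mat_spectrum A"
  shows "matrix_inv (mat z - A) *v (A *v v) = A *v (matrix_inv (mat z - A) *v v)"
proof -
  have inv: "invertible (mat z - A)" using assms by (simp add: mat_spectrum_def)
  define y where "y = matrix_inv (mat z - A) *v v"
  have "v = z *s y - A *v y"
    using matrix_inv_vector_mult(1)[OF inv, of v]
    by (simp add: y_def matrix_vector_mult_diff_rdistrib mat_vector_mult)
  hence "A *v v = (mat z - A) *v (A *v y)"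
    by (simp add: matrix_vector_mult_diff_rdistrib matrix_vector_mult_diff_distrib
        mat_vector_mult vector_scalar_commute)
  thus ?thesis using matrix_inv_vector_mult(2)[OF inv, of "A *v y"] by (simp add: y_def)
qed

lemma resolvent_eigenvector:
  assumes z: "z \<notin> mat_spectrum A" and v: "A *v v = l *s v" and "z \<noteq> l"
  shows "matrix_inv (mat z - A) *v v = (1 / (z - l)) *s v"
proof -
  have "(mat z - A) *v ((1 / (z - l)) *s v) = (1 / (z - l)) *s ((mat z - A) *v v)"
    by (rule vector_scalar_commute)
  also have "(mat z - A) *v v = (z - l) *s v"
    by (simp add: matrix_vector_mult_diff_rdistrib mat_vector_mult v vec.scale_left_diff_distrib)
  finally have "(mat z - A) *v ((1 / (z - l)) *s v) = v"
    using \<open>z \<noteq> l\<close> by (simp only: vec.scale_scale) simp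
  thus ?thesis using matrix_inv_vector_mult(2)[of "mat z - A"] z
    by (metis (no_types, lifting) mat_spectrum_def mem_Collect_eq)
qed

section \<open>The Riesz-Dunford integral applied to vectors\<close>

context
  fixes U :: "complex set" and f and A :: "complex ^ 'n ^ 'n"
  assumes U: "open U" and f: "f holomorphic_on U" and ex: "\<exists>\<gamma>. spectral_contour U A \<gamma>"
begin

text \<open>This unpacks the contour chosen by \<open>SOME\<close> in \<open>hol_calculus\<close>.
  One contour serves all vectors and coordinates, so integrals for different vectors can be
  compared.\<close>

lemma hol_calculus_vector_mult:
  obtains \<gamma> where "spectral_contour U A \<gamma>"
    and "\<And>v i. ((\<lambda>z. f z * (matrix_inv (mat z - A) *v v) $ i)
           has_contour_integral 2 * of_real pi * \<i> * (hol_calculus U f A *v v) $ i) \<gamma>"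
proof -
  define \<gamma> where "\<gamma> = (SOME \<gamma>. spectral_contour U A \<gamma>)"
  let ?R = "\<lambda>z. matrix_inv (mat z - A)"
  have \<gamma>: "spectral_contour U A \<gamma>" unfolding \<gamma>_def using ex by (rule someI_ex)
  have int: "(\<lambda>z. f z * ?R z $ i $ j) contour_integrable_on \<gamma>" for i j
  proof (rule contour_integrable_holomorphic_simple)
    show "(\<lambda>z. f z * ?R z $ i $ j) holomorphic_on (U \<inter> - mat_spectrum A)"
      by (intro holomorphic_on_mult holomorphic_on_subset[OF f]
          holomorphic_on_subset[OF holomorphic_on_resolvent]) auto
    show "open (U \<inter> - mat_spectrum A)" using U open_resolvent_set by blast
  qed (use \<gamma> in \<open>auto simp: spectral_contour_def\<close>)
  have "((\<lambda>z. f z * (?R z *v v) $ i) has_contour_integral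
      2 * of_real pi * \<i> * (hol_calculus U f A *v v) $ i) \<gamma>" for v i
  proof -
    have "((\<lambda>z. \<Sum>j\<in>UNIV. f z * ?R z $ i $ j * v $ j) has_contour_integral
        (\<Sum>j\<in>UNIV. contour_integral \<gamma> (\<lambda>z. f z * ?R z $ i $ j) * v $ j)) \<gamma>"
      by (intro has_contour_integral_sum has_contour_integral_rmul
          has_contour_integral_integral int) auto
    also have "(\<lambda>z. \<Sum>j\<in>UNIV. f z * ?R z $ i $ j * v $ j) = (\<lambda>z. f z * (?R z *v v) $ i)"
      by (simp add: matrix_vector_mult_def sum_distrib_left mult.assoc)
    also have "(\<Sum>j\<in>UNIV. contour_integral \<gamma> (\<lambda>z. f z * ?R z $ i $ j) * v $ j)
        = 2 * of_real pi * \<i> * (hol_calculus U f A *v v) $ i"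
      by (simp add: matrix_vector_mult_def hol_calculus_def Let_def \<gamma>_def sum_distrib_left)
    finally show ?thesis .
  qed
  thus ?thesis using that \<gamma> by blast
qed

lemma hol_calculus_eigenvector:
  assumes v: "A *v v = l *s v" "v \<noteq> 0"
  shows "hol_calculus U f A *v v = f l *s v"
proof -
  obtain \<gamma> where \<gamma>: "spectral_contour U A \<gamma>"
    and int: "\<And>v i. ((\<lambda>z. f z * (matrix_inv (mat z - A) *v v) $ i)
           has_contour_integral 2 * of_real pi * \<i> * (hol_calculus U f A *v v) $ i) \<gamma>"
    using hol_calculus_vector_mult by blast
  have l: "l \<in> mat_spectrum A" by (rule eigenvalue_in_mat_spectrum[OF v])
  have lU: "l \<in> U" and wl: "winding_number \<gamma> l = 1"
    using \<gamma> l by (auto simp: spectral_contour_def)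
  \<comment> \<open>The global Cauchy formula asks for winding number 0 about points outside
    \<open>U\<close>, a clause of \<open>spectral_contour\<close>; the winding number 1 about
    \<open>l\<close> then leaves exactly f(l).\<close>
  have "((\<lambda>z. f z / (z - l)) has_contour_integral (2 * pi * \<i> * winding_number \<gamma> l * f l)) \<gamma>"
    by (rule Cauchy_integral_formula_global[OF U f lU])
       (use \<gamma> l in \<open>auto simp: spectral_contour_def\<close>)
  hence cauchy: "((\<lambda>z. f z / (z - l) * v $ i) has_contour_integral (2 * pi * \<i> * f l * v $ i)) \<gamma>" for i
    using has_contour_integral_rmul[of "\<lambda>z. f z / (z - l)" _ \<gamma> "v $ i"] wl by simp
  have "(hol_calculus U f A *v v) $ i = f l * v $ i" for i
  proof -
    have "((\<lambda>z. f z / (z - l) * v $ i)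
           has_contour_integral 2 * of_real pi * \<i> * (hol_calculus U f A *v v) $ i) \<gamma>"
    proof (rule has_contour_integral_eq[OF int])
      fix z assume "z \<in> path_image \<gamma>"
      hence "z \<notin> mat_spectrum A" "z \<noteq> l" using \<gamma> l by (auto simp: spectral_contour_def)
      thus "f z * (matrix_inv (mat z - A) *v v) $ i = f z / (z - l) * v $ i"
        using resolvent_eigenvector[OF _ v(1)] by simp
    qed
    from has_contour_integral_unique[OF this cauchy] show ?thesis by simp
  qed
  thus ?thesis by (simp add: vec_eq_iff)
qed

text \<open>The constant entries of A pass through the integral, where A commutes with the
  resolvent. This makes the kernel of f(A) invariant under A.\<close>

lemma hol_calculus_commute:
  "hol_calculus U f A *v (A *v v) = A *v (hol_calculus U f A *v v)"
proof -
  obtain \<gamma> where \<gamma>: "spectral_contour U A \<gamma>"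
    and int: "\<And>v i. ((\<lambda>z. f z * (matrix_inv (mat z - A) *v v) $ i)
           has_contour_integral 2 * of_real pi * \<i> * (hol_calculus U f A *v v) $ i) \<gamma>"
    using hol_calculus_vector_mult by blast
  have "(hol_calculus U f A *v (A *v v)) $ i = (A *v (hol_calculus U f A *v v)) $ i" for i
  proof -
    have "((\<lambda>z. \<Sum>k\<in>UNIV. A $ i $ k * (f z * (matrix_inv (mat z - A) *v v) $ k)) has_contour_integral
        (\<Sum>k\<in>UNIV. A $ i $ k * (2 * of_real pi * \<i> * (hol_calculus U f A *v v) $ k))) \<gamma>"
      by (intro has_contour_integral_sum has_contour_integral_lmul int) auto
    also have "(\<Sum>k\<in>UNIV. A $ i $ k * (2 * of_real pi * \<i> * (hol_calculus U f A *v v) $ k))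
        = 2 * of_real pi * \<i> * (A *v (hol_calculus U f A *v v)) $ i"
      by (simp add: matrix_vector_mult_def[of A] sum_distrib_left mult_ac)
    finally have "((\<lambda>z. f z * (matrix_inv (mat z - A) *v (A *v v)) $ i) has_contour_integral
        2 * of_real pi * \<i> * (A *v (hol_calculus U f A *v v)) $ i) \<gamma>"
    proof (rule has_contour_integral_eq)
      fix z assume "z \<in> path_image \<gamma>"
      hence "z \<notin> mat_spectrum A" using \<gamma> by (auto simp: spectral_contour_def)
      thus "(\<Sum>k\<in>UNIV. A $ i $ k * (f z * (matrix_inv (mat z - A) *v v) $ k))
          = f z * (matrix_inv (mat z - A) *v (A *v v)) $ i"
        by (simp add: resolvent_commute)
           (simp add: matrix_vector_mult_def[of A] sum_distrib_left mult_ac)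
    qed
    from has_contour_integral_unique[OF int this] show ?thesis by simp
  qed
  thus ?thesis by (simp add: vec_eq_iff)
qed

lemma invertible_hol_calculus:
  assumes nz: "\<And>z. z \<in> mat_spectrum A \<Longrightarrow> f z \<noteq> 0"
  shows "invertible (hol_calculus U f A)"
proof (rule ccontr)
  let ?B = "hol_calculus U f A"
  let ?K = "{x. ?B *v x = 0}"
  assume "\<not> ?thesis"
  then obtain u where "?B *v u = 0" "u \<noteq> 0"
    by (auto simp: invertible_left_inverse matrix_left_invertible_ker)
  moreover have "vec.subspace ?K"
    by (auto simp: vec.subspace_def matrix_vector_right_distrib vector_scalar_commute)
  ultimately obtain l v where v: "?B *v v = 0" "v \<noteq> 0" "A *v v = l *s v"
    using invariant_subspace_eigenvector[of ?K A u] by (auto simp: hol_calculus_commute)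
  have "l \<in> mat_spectrum A" by (rule eigenvalue_in_mat_spectrum[OF v(3,2)])
  moreover have "f l *s v = 0" using hol_calculus_eigenvector[OF v(3,2)] v(1) by simp
  ultimately show False using nz v(2) by simp
qed

end

subsection \<open>Numerical radius\<close>

lemma norm_eigenvalue_le_numerical_radius:
  assumes "A *v v = l *s v" "v \<noteq> 0"
  shows "cmod l \<le> numerical_radius A"
  using eigenvalue_in_mat_spectrum[OF assms] spectrum_subset_numerical_range[of A]
    numerical_radius_attained(2)[of _ A] unfolding numerical_range_def by blast

text \<open>The spectrum lies in the numerical range, whose points have positive real part by
  accretivity.\<close>

lemma accretive_spectrum_Re_pos:
  assumes "accretive A" "z \<in> mat_spectrum A"
  shows "Re z > 0"
proof -
  obtain x where "norm x = 1" "z = cinner (A *v x) x"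
    using assms(2) spectrum_subset_numerical_range[of A] unfolding numerical_range_def by blast
  thus ?thesis using assms(1) unfolding accretive_def pos_definite_def
    by (metis Re_cinner_mat_Re norm_zero zero_neq_one)
qed

theorem theorem3p2:
  fixes A :: "complex ^ 'n ^ 'n" and \<alpha> t :: real
  assumes "0 \<le> \<alpha>" and "\<alpha> < pi / 2"
    and "sectorial \<alpha> A"
    and "accretive A"
    and "t \<in> {0..1}"
  shows "cos (t * \<alpha>) * cos \<alpha> powr (2 * t) * numerical_radius A powr (- t)
           \<le> numerical_radius (matrix_inv (mat_powr A t))"
proof -
  let ?f = "\<lambda>z. z powr of_real t :: complex"
  let ?B = "mat_powr A t"
  have U: "open (- \<real>\<^sub>\<le>\<^sub>0 :: complex set)" by (simp add: open_Compl)
  have f: "?f holomorphic_on (- \<real>\<^sub>\<le>\<^sub>0)" by (intro holomorphic_intros) auto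
  note calc = U f accretive_spectral_contour_exists[OF assms(4)]
  have nz: "z \<noteq> 0" if "z \<in> mat_spectrum A" for z
    using accretive_spectrum_Re_pos[OF assms(4) that] by auto
  have inv: "invertible ?B"
    unfolding mat_powr_def using nz by (intro invertible_hol_calculus[OF calc]) auto
  obtain u :: "complex ^ 'n" where "norm u = 1" using unit_vec_exists by blast
  hence "u \<noteq> 0" by auto
  \<comment> \<open>The whole space is an invariant subspace, so any nonzero starting vector leads
    to an eigenvector of \<open>A\<close>.\<close>
  then obtain l v where v: "A *v v = l *s v" "v \<noteq> 0"
    using invariant_subspace_eigenvector[of UNIV A u] by auto
  have l: "l \<noteq> 0" using nz eigenvalue_in_mat_spectrum[OF v] by blast
  have "?B *v v = ?f l *s v"
    unfolding mat_powr_def by (rule hol_calculus_eigenvector[OF calc v])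
  hence "v = ?f l *s (matrix_inv ?B *v v)"
    using matrix_inv_vector_mult(2)[OF inv, of v] by (simp add: vector_scalar_commute)
  hence "matrix_inv ?B *v v = inverse (?f l) *s v"
    using l by (metis (no_types, lifting) powr_eq_0_iff vec.scale_left_imp_eq vec.scale_one
        vec.scale_scale left_inverse)
  hence "cmod (inverse (?f l)) \<le> numerical_radius (matrix_inv ?B)"
    using v(2) by (rule norm_eigenvalue_le_numerical_radius)
  \<comment> \<open>For a real exponent the modulus of l^t is |l|^t, independently of the argument
    of l.\<close>
  hence le: "cmod l powr (- t) \<le> numerical_radius (matrix_inv ?B)"
    by (simp add: norm_inverse norm_powr_real_powr' powr_minus)
  \<comment> \<open>The exponent -t is nonpositive, so the power decreases in its base; l being
    nonzero keeps the base |l| positive.\<close>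
  have "numerical_radius A powr (- t) \<le> cmod l powr (- t)"
    using assms(5) l norm_eigenvalue_le_numerical_radius[OF v] by (intro powr_mono2') auto
  moreover have "cos (t * \<alpha>) * cos \<alpha> powr (2 * t) \<le> 1"
  proof -
    have "0 \<le> cos \<alpha>" using assms by (intro cos_ge_zero) auto
    hence "cos \<alpha> powr (2 * t) \<le> 1" using assms(5) by (intro powr_le1) auto
    thus ?thesis
      using mult_mono[of "cos (t * \<alpha>)" 1 "cos \<alpha> powr (2 * t)" 1] by simp
  qed
  hence "cos (t * \<alpha>) * cos \<alpha> powr (2 * t) * numerical_radius A powr (- t)
      \<le> 1 * numerical_radius A powr (- t)"
    by (rule mult_right_mono) simp
  ultimately show ?thesis using le by linarith
qed

end
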